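(* Let $L_0, L_1, L_2, L_3$ be the real vector spaces generated, respectively, by the sites of the triply periodic cubical lattice $L$ of edge size $h$ and even period in each of the three coordinate directions, and by all the oriented edges, oriented square faces and oriented cubes of side length $2h$ in the lattice (with the relation (cell, opposite orientation) $= -$(cell, orientation)), as specified in the context. Put $L_{-1}=L_4=0$. (1) There are canonical isomorphisms (duality) $\ast: L_0 \leftrightarrow L_3$ and $\ast: L_1 \leftrightarrow L_2$, the two directions being inverse to each other, where $\ast$ takes each oriented cell to the cell of complementary dimension having the same center point and meeting it transversally there, with an orientation whose sign is fixed by comparison with the global orientation of space, by a rule depending only on the degree of the cell. (2) If $T$ denotes the (3-dimensional) tangent space to any point of three space, there is a canonical isomorphism $\{\,\}: L_0\otimes T \leftrightarrow L_1$. (3) There are linear maps $\partial: L_i\to L_{i-1}$ (the cellular boundary) and $\delta: L_i\to L_{i+1}$ (the cellular coboundary) which, together with $\ast$, satisfy $$\partial\circ\partial = 0,\qquad \delta\circ\delta=0,\qquad \ast\circ\delta = \partial\circ\ast,\qquad \ast\circ\partial=\delta\circ\ast .$$ (4) Define $\Delta = \partial\circ\delta+\delta\circ\partial$ on $L_i$ for $i > 0$; this extends the definition $\Delta=\partial\circ\delta$ in degree $0$. Then for every $i\in\{0,1,2,3\}$ there is an orthogonal direct sum decomposition (the decomposition of Hodge) $$L_i = \operatorname{im}\partial\ \oplus\ \operatorname{im}\delta\ \oplus\ \ker\Delta ,$$ where $\operatorname{im}\partial=\partial(L_{i+1})$, $\operatorname{im}\delta=\delta(L_{i-1})$, $\ker\Delta=\ker(\Delta: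 L_i\to L_i)$, and orthogonality is with respect to the inner product on $L_i$ for which the cellular basis is orthonormal.
   Context: Lattice: $L$ is the set of vertices (sites) of a regular cubical lattice of edge size $h>0$ in periodic, oriented three space, of even period in the three orthogonal directed coordinate directions $x,y,z$. That is, the sites are $h\cdot(\mathbb{Z}/2a\times \mathbb{Z}/2b\times\mathbb{Z}/2c)$ for some positive integers $a,b,c$, lying in the torus $\mathbb{R}^3/(2ah\mathbb{Z}\times 2bh\mathbb{Z}\times 2ch\mathbb{Z})$. Cells: The positive dimensional cells considered are all (possibly overlapping) axis-parallel edges, square faces and cubes of side length $2h$ (not $h$) whose corner vertices are sites of $L$. Each such cell has a center point, which is again a site. For every site $q$ there are exactly three edges (in the $x$, $y$, $z$ directions), three faces (one perpendicular to each coordinate direction) and one cube of side length $2h$ centered at $q$; cells with different centers or different directions are counted as different generators. Chain spaces: $L_0$ is the vector space generated by the sites. $L_1,L_2,L_3$ are the vector spaces generated by the oriented edges, faces and cubes of side length $2h$ modulo (cell, orientation) $=-$(cell, opposite orientation). The cellular basis of $L_i$ consists of the $i$-cells, one orientation being chosen for each; the inner product making it orthonormal does not depend on these choices. Boundary and coboundary: $\partial$ is the usual boundary of combinatorial topology, computed with the cells of side length $2h$. The boundary of an oriented edge of length $2h$ is its terminal vertex minus its initial vertex. The boundary of an oriented square of side $2h$ is the sum of its $4$ edges of length $2h$ with induced orientation. The boundary of an oriented cube of side $2h$ is the sum of its $6$ faces of side $2h$ with orientation induced by the outward normal. $\partial$ is zero on $L_0$. $\delta$ is the coboundary, i.e.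 the adjoint of $\partial$ with respect to the inner product for which the cellular basis is orthonormal; it is zero on $L_3$. The map $\{\,\}$: an element of $L_0\otimes T$ is a lattice vector field (a tangent vector at each site). If the vector at site $q$ has $(x,y,z)$ components $(a,b,c)$, then $\{\,\}$ attaches the coefficients $a,b,c$ to the three edges of length $2h$ with center $q$ in the $x,y,z$ directions, oriented in their positive sense. *)

theory Defs
  imports "HOL-Analysis.Analysis"
begin

section \<open>Lattice, cells and orientations\<close>

datatype dir = DX | DY | DZ

instance dir :: finite
proof
  have "(UNIV :: dir set) = {DX, DY, DZ}"
    using dir.exhaust by auto
  then show "finite (UNIV :: dir set)" by (metis finite.emptyI finite.insertI)
qed

fun dir_rank :: "dir \<Rightarrow> nat" where
  "dir_rank DX = 0" | "dir_rank DY = 1" | "dir_rank DZ = 2"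

text \<open>The tangent space \<open>T\<close> of three space; a vector has the components
  \<open>v $ DX\<close>, \<open>v $ DY\<close>, \<open>v $ DZ\<close>.\<close>
type_synonym tangent = "real ^ dir"

text \<open>The type \<open>'a bit0\<close> is the ring of integers modulo \<open>2 * CARD('a)\<close>.  A site is given by its
  integer coordinates in units of the edge size \<open>h\<close>; the three half-periods are \<open>CARD('a)\<close>,
  \<open>CARD('b)\<close>, \<open>CARD('c)\<close>, i.e. arbitrary positive integers.\<close>
type_synonym ('a, 'b, 'c) site = "'a bit0 \<times> 'b bit0 \<times> 'c bit0"

text \<open>The cell \<open>(q, D)\<close> of side length \<open>2h\<close> has center \<open>q\<close> and is parallel to the directions in \<open>D\<close>;
  its dimension is \<open>card D\<close>.  As a generator it is determined by \<open>q\<close> and \<open>D\<close>, even when some period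
  is as small as \<open>2h\<close> and cells with different centers coincide as point sets.\<close>
type_synonym ('a, 'b, 'c) cell = "('a, 'b, 'c) site \<times> dir set"

fun coord :: "('a::finite, 'b::finite, 'c::finite) site \<Rightarrow> dir \<Rightarrow> int" where
  "coord (x, y, z) DX = Rep_bit0 x"
| "coord (x, y, z) DY = Rep_bit0 y"
| "coord (x, y, z) DZ = Rep_bit0 z"

fun period :: "('a::finite, 'b::finite, 'c::finite) site \<Rightarrow> dir \<Rightarrow> int" where
  "period q DX = 2 * int CARD('a)"
| "period q DY = 2 * int CARD('b)"
| "period q DZ = 2 * int CARD('c)"

text \<open>The points of a cell in the torus, described by their full preimage in \<open>real ^ dir\<close>;
  \<open>cell_points h (q, {})\<close> is the preimage of the site \<open>q\<close> itself.\<close>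
definition cell_points ::
  "real \<Rightarrow> ('a::finite, 'b::finite, 'c::finite) cell \<Rightarrow> (real ^ dir) set" where
  "cell_points h \<sigma> = {p. \<exists>m :: dir \<Rightarrow> int. \<forall>d.
     \<bar>p $ d - h * real_of_int (coord (fst \<sigma>) d + m d * period (fst \<sigma>) d)\<bar>
       \<le> (if d \<in> snd \<sigma> then h else 0)}"

text \<open>\<open>(d, 1)\<close> and \<open>(d, -1)\<close> stand for the unit vectors along the positive and negative \<open>d\<close>-axis.
  An orientation of a cell is given by an ordered frame of such vectors spanning its directions.\<close>
type_synonym sdir = "dir \<times> int"

fun shift :: "('a::finite, 'b::finite, 'c::finite) site \<Rightarrow> sdir \<Rightarrow> ('a, 'b, 'c) site" where
  "shift (x, y, z) (DX, s) = (x + of_int s, y, z)"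
| "shift (x, y, z) (DY, s) = (x, y + of_int s, z)"
| "shift (x, y, z) (DZ, s) = (x, y, z + of_int s)"

definition frame :: "sdir list \<Rightarrow> bool" where
  "frame vs \<longleftrightarrow> distinct (map fst vs) \<and> snd ` set vs \<subseteq> {1, -1}"

text \<open>The determinant of a frame with respect to the frame of positive unit vectors along the same
  axes, in the order x, y, z.  For a frame of length 3 the value 1 means that it is positive for
  the global orientation of space.\<close>
fun frame_sign :: "sdir list \<Rightarrow> real" where
  "frame_sign [] = 1"
| "frame_sign (v # vs) =
     of_int (snd v) * (-1) ^ length (filter (\<lambda>w. dir_rank (fst w) < dir_rank (fst v)) vs)
       * frame_sign vs"

definition pos_frame :: "dir set \<Rightarrow> sdir list" where
  "pos_frame D = map (\<lambda>d. (d, 1)) (filter (\<lambda>d. d \<in> D) [DX, DY, DZ])"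


section \<open>Chains\<close>

text \<open>The direct sum of all chain spaces.  The standard basis vectors \<open>axis (q, D) 1\<close> are the cells,
  each with the orientation given by \<open>pos_frame D\<close>; the standard inner product of the type makes
  this cellular basis orthonormal.\<close>
type_synonym ('a, 'b, 'c) chain = "real ^ ('a, 'b, 'c) cell"

text \<open>The cell with center \<open>q\<close> and axes \<open>fst ` set vs\<close>, oriented by the frame \<open>vs\<close>.  Frames of
  opposite orientation give opposite chains.  The empty frame gives the site \<open>q\<close>.\<close>
definition ocell ::
  "('a::finite, 'b::finite, 'c::finite) site \<Rightarrow> sdir list \<Rightarrow> ('a, 'b, 'c) chain" where
  "ocell q vs = frame_sign vs *\<^sub>R axis (q, fst ` set vs) 1"

definition chain_space :: "int \<Rightarrow> ('a::finite, 'b::finite, 'c::finite) chain set" where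
  "chain_space i = span {ocell q vs | q vs. frame vs \<and> int (length vs) = i}"

text \<open>The boundary of a cell is the sum of its facets over the outward unit normals \<open>n = (d, s)\<close>,
  where the orientation \<open>w\<close> of a facet is the induced one if the frame \<open>n # w\<close> is positive for the
  cell.  For an edge this is terminal minus initial vertex.\<close>
definition cell_boundary ::
  "('a::finite, 'b::finite, 'c::finite) cell \<Rightarrow> ('a, 'b, 'c) chain" where
  "cell_boundary \<sigma> = (\<Sum>d\<in>snd \<sigma>. \<Sum>s\<in>{1, -1}.
     frame_sign ((d, s) # pos_frame (snd \<sigma> - {d})) *\<^sub>R
       ocell (shift (fst \<sigma>) (d, s)) (pos_frame (snd \<sigma> - {d})))"

definition boundary ::
  "('a::finite, 'b::finite, 'c::finite) chain \<Rightarrow> ('a, 'b, 'c) chain" where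
  "boundary c = (\<Sum>\<sigma>\<in>UNIV. (c $ \<sigma>) *\<^sub>R cell_boundary \<sigma>)"

definition coboundary ::
  "('a::finite, 'b::finite, 'c::finite) chain \<Rightarrow> ('a, 'b, 'c) chain" where
  "coboundary = adjoint boundary"

definition laplacian ::
  "('a::finite, 'b::finite, 'c::finite) chain \<Rightarrow> ('a, 'b, 'c) chain" where
  "laplacian c = boundary (coboundary c) + coboundary (boundary c)"


section \<open>Duality\<close>

text \<open>The sign rule 1, -1, -1, 1 in degrees 0, 1, 2, 3.  Commutation of the duality with boundary
  and coboundary forces this rule up to one overall sign, which is normalised here so that a site
  is dual to the positively oriented cube around it.\<close>
definition dual_sign :: "nat \<Rightarrow> real" where
  "dual_sign k = (-1) ^ (k * (k + 1) div 2)"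

definition star ::
  "('a::finite, 'b::finite, 'c::finite) chain \<Rightarrow> ('a, 'b, 'c) chain" where
  "star c = (\<Sum>(q, D)\<in>UNIV. (c $ (q, D)) *\<^sub>R
     (dual_sign (card D) * frame_sign (pos_frame D @ pos_frame (- D))) *\<^sub>R
       ocell q (pos_frame (- D)))"


section \<open>Lattice vector fields\<close>

text \<open>The tensor product of the space of 0-chains with \<open>T\<close>, in the form of lattice vector fields;
  \<open>tensor\<close> is its canonical bilinear map, see \<open>tensor_universal\<close> below.\<close>
type_synonym ('a, 'b, 'c) field = "tangent ^ ('a, 'b, 'c) site"

definition tensor ::
  "('a::finite, 'b::finite, 'c::finite) chain \<Rightarrow> tangent \<Rightarrow> ('a, 'b, 'c) field" where
  "tensor c v = (\<chi> q. (c $ (q, {})) *\<^sub>R v)"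

definition braces ::
  "('a::finite, 'b::finite, 'c::finite) field \<Rightarrow> ('a, 'b, 'c) chain" where
  "braces V = (\<Sum>q\<in>UNIV. \<Sum>d\<in>UNIV. (V $ q $ d) *\<^sub>R ocell q [(d, 1)])"


section \<open>Orthogonal decompositions\<close>

definition orthogonal_direct_sum3 ::
  "'v::real_inner set \<Rightarrow> 'v set \<Rightarrow> 'v set \<Rightarrow> 'v set \<Rightarrow> bool" where
  "orthogonal_direct_sum3 V A B C \<longleftrightarrow>
     subspace A \<and> subspace B \<and> subspace C \<and>
     (\<forall>a\<in>A. \<forall>b\<in>B. orthogonal a b) \<and>
     (\<forall>a\<in>A. \<forall>c\<in>C. orthogonal a c) \<and>
     (\<forall>b\<in>B. \<forall>c\<in>C. orthogonal b c) \<and>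
     V = {a + b + c | a b c. a \<in> A \<and> b \<in> B \<and> c \<in> C} \<and>
     (\<forall>v\<in>V. \<exists>!t. t \<in> A \<times> B \<times> C \<and> v = fst t + fst (snd t) + snd (snd t))"


section \<open>Basic facts\<close>

lemma UNIV_dir: "(UNIV :: dir set) = {DX, DY, DZ}"
  using dir.exhaust by auto

lemma frame_sign_square:
  assumes "frame vs"
  shows "frame_sign vs * frame_sign vs = 1"
  using assms
proof (induction vs)
  case (Cons v vs)
  have IH: "frame_sign vs * frame_sign vs = 1"
    using Cons by (auto simp: frame_def)
  have s: "(of_int (snd v) :: real) * of_int (snd v) = 1"
    using Cons.prems by (auto simp: frame_def)
  have p: "((-1) ^ n :: real) * (-1) ^ n = 1" for n
    by (simp flip: power_mult_distrib)
  have "frame_sign (v # vs) * frame_sign (v # vs) =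
      (of_int (snd v) * of_int (snd v)) *
      ((-1) ^ length (filter (\<lambda>w. dir_rank (fst w) < dir_rank (fst v)) vs) *
       (-1) ^ length (filter (\<lambda>w. dir_rank (fst w) < dir_rank (fst v)) vs)) *
      (frame_sign vs * frame_sign vs)"
    by (simp only: frame_sign.simps mult_ac)
  also have "\<dots> = 1" by (simp only: IH s p mult_1)
  finally show ?case .
qed auto

lemma pos_frame_simps:
  "pos_frame {} = []"
  "frame (pos_frame D)"
  "fst ` set (pos_frame D) = D"
  "length (pos_frame D) = card D"
  "frame_sign (pos_frame D) = 1"
proof -
  show "pos_frame {} = []" by (simp add: pos_frame_def)
  show 1: "frame (pos_frame D)" by (auto simp: pos_frame_def frame_def)
  show 2: "fst ` set (pos_frame D) = D"
  proof (rule set_eqI)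
    fix x show "x \<in> fst ` set (pos_frame D) \<longleftrightarrow> x \<in> D"
      by (cases x) (auto simp: pos_frame_def)
  qed
  have "length (pos_frame D) = length (map fst (pos_frame D))" by simp
  also have "\<dots> = card (set (map fst (pos_frame D)))"
    using 1 by (metis frame_def distinct_card)
  finally show "length (pos_frame D) = card D" using 2 by simp
  show "frame_sign (pos_frame D) = 1" by (auto simp: pos_frame_def)
qed

lemma ocell_opposite:
  assumes "fst ` set ws = fst ` set vs" "frame_sign ws = - frame_sign vs"
  shows "ocell q ws = - ocell q vs"
  using assms by (simp add: ocell_def)

lemma axis_eq_ocell: "axis (q, D) 1 = ocell q (pos_frame D)"
  by (simp add: ocell_def pos_frame_simps)

lemma chain_expansion:
  fixes c :: "('a::finite, 'b::finite, 'c::finite) chain"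
  shows "c = (\<Sum>(q, D)\<in>UNIV. (c $ (q, D)) *\<^sub>R ocell q (pos_frame D))"
proof -
  have "(\<Sum>(q, D)\<in>UNIV. (c $ (q, D)) *\<^sub>R ocell q (pos_frame D)) =
      (\<Sum>\<sigma>\<in>UNIV. (c $ \<sigma>) *\<^sub>R axis \<sigma> 1)"
    by (intro sum.cong) (auto simp: axis_eq_ocell)
  also have "\<dots> = c"
    by (simp add: vec_eq_iff axis_def if_distrib[of "\<lambda>x. _ * x"] cong: if_cong)
  finally show ?thesis ..
qed

text \<open>The chains are the real vector space generated by the oriented cells modulo
  (cell, opposite orientation) = -(cell, orientation).\<close>
lemma ocell_universal:
  fixes \<phi> :: "('a::finite, 'b::finite, 'c::finite) site \<Rightarrow> sdir list \<Rightarrow> 'v::real_vector"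
  assumes \<phi>: "\<And>q vs ws. \<lbrakk>frame vs; frame ws; fst ` set vs = fst ` set ws\<rbrakk> \<Longrightarrow>
      \<phi> q ws = (frame_sign vs * frame_sign ws) *\<^sub>R \<phi> q vs"
  shows "\<exists>!g. linear g \<and> (\<forall>q vs. frame vs \<longrightarrow> g (ocell q vs) = \<phi> q vs)"
proof (rule ex1I)
  define g where "g = (\<lambda>c :: ('a, 'b, 'c) chain.
      \<Sum>(q, D)\<in>UNIV. (c $ (q, D)) *\<^sub>R \<phi> q (pos_frame D))"
  have lin: "linear g"
    unfolding g_def
    by (rule linearI)
       (simp_all add: scaleR_left_distrib sum.distrib case_prod_beta scaleR_sum_right)
  have "g (ocell q vs) = \<phi> q vs" if "frame vs" for q vs
  proof -
    let ?D = "fst ` set vs"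
    have "g (axis (q, ?D) 1) = (\<Sum>\<sigma>\<in>UNIV. if \<sigma> = (q, ?D) then \<phi> q (pos_frame ?D) else 0)"
      unfolding g_def by (intro sum.cong) (simp_all add: axis_def split: prod.split)
    then have ga: "g (axis (q, ?D) 1) = \<phi> q (pos_frame ?D)" by simp
    have "g (ocell q vs) = frame_sign vs *\<^sub>R \<phi> q (pos_frame ?D)"
      unfolding ocell_def by (simp add: linear_scale[OF lin] ga)
    also have "\<dots> = \<phi> q vs"
      using \<phi>[of "pos_frame ?D" vs q] that by (simp add: pos_frame_simps)
    finally show ?thesis .
  qed
  with lin show "linear g \<and> (\<forall>q vs. frame vs \<longrightarrow> g (ocell q vs) = \<phi> q vs)" by blast
  fix f assume f: "linear f \<and> (\<forall>q vs. frame vs \<longrightarrow> f (ocell q vs) = \<phi> q vs)"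
  then have flin: "linear f" and fo: "\<And>q vs. frame vs \<Longrightarrow> f (ocell q vs) = \<phi> q vs"
    by blast+
  show "f = g"
  proof
    fix c :: "('a, 'b, 'c) chain"
    have "f c = f (\<Sum>\<sigma>\<in>UNIV. (c $ \<sigma>) *\<^sub>R ocell (fst \<sigma>) (pos_frame (snd \<sigma>)))"
      using chain_expansion[of c] by (simp add: case_prod_beta)
    also have "\<dots> = (\<Sum>\<sigma>\<in>UNIV. (c $ \<sigma>) *\<^sub>R \<phi> (fst \<sigma>) (pos_frame (snd \<sigma>)))"
      by (simp add: linear_sum linear_scale flin fo pos_frame_simps)
    also have "\<dots> = g c" by (simp add: g_def case_prod_beta)
    finally show "f c = g c" .
  qed
qed

lemma chain_space_trivial:
  "chain_space (-1) = ({0} :: ('a::finite, 'b::finite, 'c::finite) chain set)"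
  "chain_space 4 = ({0} :: ('a::finite, 'b::finite, 'c::finite) chain set)"
proof -
  show "chain_space (-1) = ({0} :: ('a, 'b, 'c) chain set)" by (simp add: chain_space_def)
  have "length vs \<le> 3" if "frame vs" for vs
  proof -
    have "length vs = card (set (map fst vs))"
      using that by (metis frame_def distinct_card length_map)
    also have "\<dots> \<le> card (UNIV :: dir set)" by (intro card_mono) auto
    also have "\<dots> = 3" by (simp add: UNIV_dir)
    finally show ?thesis .
  qed
  then have "{ocell q vs | q vs. frame vs \<and> int (length vs) = 4} =
      ({} :: ('a, 'b, 'c) chain set)" by fastforce
  then show "chain_space 4 = ({0} :: ('a, 'b, 'c) chain set)" by (simp only: chain_space_def span_empty)
qed

lemma boundary_axis: "boundary (axis \<sigma> 1) = cell_boundary \<sigma>"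
proof -
  have "boundary (axis \<sigma> 1) = (\<Sum>\<tau>\<in>UNIV. if \<tau> = \<sigma> then cell_boundary \<sigma> else 0)"
    unfolding boundary_def by (intro sum.cong) (auto simp: axis_def)
  then show ?thesis by simp
qed

lemma linear_boundary: "linear boundary"
  unfolding boundary_def
  by (rule linearI) (simp_all add: scaleR_left_distrib sum.distrib scaleR_sum_right)

lemma boundary_ocell:
  "boundary (ocell q vs) = frame_sign vs *\<^sub>R cell_boundary (q, fst ` set vs)"
  by (simp add: ocell_def linear_scale[OF linear_boundary] boundary_axis)

lemma boundary_edge:
  assumes "frame [(d, s)]"
  shows "boundary (ocell q [(d, s)]) = ocell (shift q (d, s)) [] - ocell (shift q (d, - s)) []"
  using assms unfolding boundary_ocell
  by (cases d) (auto simp: cell_boundary_def frame_def pos_frame_def ocell_def)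

lemma boundary_square:
  assumes "frame [(d, s), (e, t)]"
  shows "boundary (ocell q [(d, s), (e, t)]) =
      ocell (shift q (d, s)) [(e, t)] - ocell (shift q (d, - s)) [(e, t)]
      - ocell (shift q (e, t)) [(d, s)] + ocell (shift q (e, - t)) [(d, s)]"
  using assms unfolding boundary_ocell
  by (cases d; cases e)
     (auto simp: cell_boundary_def frame_def pos_frame_def ocell_def insert_Diff_if)

lemma boundary_cube:
  "boundary (ocell q [(DX, 1), (DY, 1), (DZ, 1)]) =
      ocell (shift q (DX, 1)) [(DY, 1), (DZ, 1)] - ocell (shift q (DX, - 1)) [(DY, 1), (DZ, 1)]
      + ocell (shift q (DY, 1)) [(DZ, 1), (DX, 1)] - ocell (shift q (DY, - 1)) [(DZ, 1), (DX, 1)]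
      + ocell (shift q (DZ, 1)) [(DX, 1), (DY, 1)] - ocell (shift q (DZ, - 1)) [(DX, 1), (DY, 1)]"
  unfolding boundary_ocell
  by (simp add: cell_boundary_def pos_frame_def ocell_def insert_Diff_if insert_commute)

lemma tensor_universal:
  fixes \<beta> :: "('a::finite, 'b::finite, 'c::finite) chain \<Rightarrow> tangent \<Rightarrow> 'v::real_vector"
  assumes lin1: "\<And>v. linear (\<lambda>c. \<beta> c v)" and lin2: "\<And>c. linear (\<beta> c)"
  shows "\<exists>!g. linear g \<and> (\<forall>c\<in>chain_space 0. \<forall>v. g (tensor c v) = \<beta> c v)"
proof (rule ex1I)
  have gen: "{ocell q vs | q vs. frame vs \<and> int (length vs) = 0} =
      (range (\<lambda>q. ocell q []) :: ('a, 'b, 'c) chain set)"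
    by (auto simp: frame_def)
  have ten: "tensor (ocell q []) v = (\<chi> p. if p = q then v else 0)"
    for q :: "('a, 'b, 'c) site" and v
    by (auto simp: tensor_def ocell_def axis_def vec_eq_iff)
  have lint: "linear (\<lambda>c. tensor c v :: ('a, 'b, 'c) field)" for v
    by (rule linearI) (auto simp: tensor_def vec_eq_iff algebra_simps)
  define g where "g = (\<lambda>V :: ('a, 'b, 'c) field. \<Sum>q\<in>UNIV. \<beta> (ocell q []) (V $ q))"
  have lin: "linear g"
    unfolding g_def
    by (rule linearI)
       (simp_all add: linear_add[OF lin2] linear_scale[OF lin2] sum.distrib scaleR_sum_right)
  have gt: "g (tensor (ocell q []) v) = \<beta> (ocell q []) v" for q v
  proof -
    have "g (tensor (ocell q []) v) = (\<Sum>p\<in>UNIV. if p = q then \<beta> (ocell q []) v else 0)"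
      unfolding g_def ten by (intro sum.cong) (auto simp: linear_0[OF lin2])
    then show ?thesis by simp
  qed
  have "g (tensor c v) = \<beta> c v" if "c \<in> chain_space 0" for c v
  proof -
    have "c \<in> span (range (\<lambda>q. ocell q []))" using that gen by (simp add: chain_space_def)
    then show ?thesis
      by (rule linear_eq_on_span[OF linear_compose[OF lint lin, unfolded o_def] lin1, rotated])
         (auto simp: gt)
  qed
  with lin show "linear g \<and> (\<forall>c\<in>chain_space 0. \<forall>v. g (tensor c v) = \<beta> c v)" by blast
  fix f assume f: "linear f \<and> (\<forall>c\<in>chain_space 0. \<forall>v. f (tensor c v) = \<beta> c v)"
  have mem: "ocell q [] \<in> chain_space 0" for q :: "('a, 'b, 'c) site"
    unfolding chain_space_def gen by (intro span_base) auto
  show "f = g"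
  proof
    fix V :: "('a, 'b, 'c) field"
    have V: "V = (\<Sum>q\<in>UNIV. tensor (ocell q []) (V $ q))"
      by (simp add: ten vec_eq_iff)
    have "f V = (\<Sum>q\<in>UNIV. f (tensor (ocell q []) (V $ q)))"
      using f by (subst V) (simp add: linear_sum)
    also have "\<dots> = g V" using f mem by (simp add: g_def)
    finally show "f V = g V" .
  qed
qed

end

theory Submission
  imports Defs
begin

text \<open>
  A chain is a family of functions \<open>q \<mapsto> c $ (q, D)\<close> on the sites, one for each set \<open>D\<close> of
  directions; it behaves like a differential form, \<open>D\<close> naming the monomial \<open>dx\<^sub>D\<close>.  Since the cells
  have side length \<open>2h\<close> while their centers run through all sites, boundary and coboundary both
  have the form of an exterior derivative in which every partial derivative is the same central
  difference \<open>f (q + e\<^sub>d) - f (q - e\<^sub>d)\<close>, and the dual of the cell \<open>(q, D)\<close> is \<open>(q, - D)\<close> with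
  the same center.  This coincidence is what makes the duality exact on the lattice.

  Everything about orientations reduces to one sign, \<open>shuffle_sign D E\<close>, given by the parity of
  the number of inversions between two sets of directions.  It is multiplicative in each argument
  over disjoint unions, and exchanging its arguments costs \<open>(-1) ^ (card D * card E)\<close>.  In
  coordinates (\<open>coboundary_nth\<close>, \<open>boundary_nth\<close>, \<open>star_nth\<close>) the algebraic relations become
  consequences of these rules.  \<open>\<partial> \<circ> \<partial> = 0\<close> holds because central differences commute while
  the signs of two removed directions anticommute; \<open>\<delta> \<circ> \<delta> = 0\<close> follows by adjunction.  The
  duality turns the coboundary into the boundary because the degree dependent factor \<open>dual_sign\<close>
  compensates the sign of moving one direction past the others (\<open>star_sign_insert\<close>), and since it
  is an involution the companion relation follows by conjugation.

  The Hodge decomposition is linear algebra (\<open>hodge_decomposition\<close>): for a differential and its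
  adjoint on a Euclidean space, the orthogonal complement of the two images consists exactly of the
  vectors killed by both maps, and these are the kernel of the Laplacian because
  \<open>\<Delta>c \<bullet> c\<close> is the sum of the squared norms of \<open>\<delta>c\<close> and \<open>\<partial>c\<close>.  It applies in each degree because
  the chains of degree \<open>i\<close> are those supported on the cells of dimension \<open>i\<close> (\<open>chain_space_iff\<close>).
\<close>

section \<open>Signs of frames\<close>

definition inversions :: "dir set \<Rightarrow> dir set \<Rightarrow> (dir \<times> dir) set" where
  "inversions D E = {(d, e). d \<in> D \<and> e \<in> E \<and> dir_rank e < dir_rank d}"

text \<open>The sign of the permutation that sorts the increasing list of \<open>D\<close> followed by the increasing
  list of \<open>E\<close>, for disjoint \<open>D\<close> and \<open>E\<close>.\<close>
definition shuffle_sign :: "dir set \<Rightarrow> dir set \<Rightarrow> real" where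
  "shuffle_sign D E = (-1) ^ card (inversions D E)"

lemma dir_rank_eq_iff: "dir_rank d = dir_rank e \<longleftrightarrow> d = e"
  by (cases d; cases e) simp_all

lemma shuffle_sign_square: "shuffle_sign D E * shuffle_sign D E = 1"
  by (simp add: shuffle_sign_def flip: power_mult_distrib)

lemma shuffle_sign_Un_left:
  assumes "D \<inter> D' = {}"
  shows "shuffle_sign (D \<union> D') E = shuffle_sign D E * shuffle_sign D' E"
proof -
  have "inversions (D \<union> D') E = inversions D E \<union> inversions D' E"
    by (auto simp: inversions_def)
  moreover have "inversions D E \<inter> inversions D' E = {}"
    using assms by (auto simp: inversions_def)
  ultimately show ?thesis
    by (simp add: shuffle_sign_def card_Un_disjoint power_add)
qed

lemma shuffle_sign_Un_right:
  assumes "E \<inter> E' = {}"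
  shows "shuffle_sign D (E \<union> E') = shuffle_sign D E * shuffle_sign D E'"
proof -
  have "inversions D (E \<union> E') = inversions D E \<union> inversions D E'"
    by (auto simp: inversions_def)
  moreover have "inversions D E \<inter> inversions D E' = {}"
    using assms by (auto simp: inversions_def)
  ultimately show ?thesis
    by (simp add: shuffle_sign_def card_Un_disjoint power_add)
qed

text \<open>Every pair in \<open>D \<times> E\<close> consists of distinct directions, so it is an inversion either as it stands
  or after exchanging its entries.\<close>
lemma shuffle_sign_swap:
  assumes "D \<inter> E = {}"
  shows "shuffle_sign D E * shuffle_sign E D = (-1) ^ (card D * card E)"
proof -
  have "D \<times> E = inversions D E \<union> prod.swap ` inversions E D"
  proof (intro set_eqI iffI)
    fix x assume x: "x \<in> D \<times> E"
    then obtain d e where x_eq: "x = (d, e)" and de: "d \<in> D" "e \<in> E" by auto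
    with assms have "dir_rank d \<noteq> dir_rank e" by (auto simp: dir_rank_eq_iff)
    with de show "x \<in> inversions D E \<union> prod.swap ` inversions E D"
      by (auto simp: x_eq inversions_def image_iff)
  qed (auto simp: inversions_def)
  moreover have "inversions D E \<inter> prod.swap ` inversions E D = {}"
    by (auto simp: inversions_def)
  ultimately have "card (D \<times> E) = card (inversions D E) + card (prod.swap ` inversions E D)"
    by (metis card_Un_disjoint finite)
  also have "card (prod.swap ` inversions E D) = card (inversions E D)"
    by (rule card_image) (auto simp: inj_on_def)
  finally show ?thesis
    by (simp add: shuffle_sign_def card_cartesian_product power_add)
qed

text \<open>The inversions inside the two parts are counted by their own signs.  Those between the parts
  depend only on the sets of directions, not on the order or the signs of the vectors; this
  is why orientations of arbitrary frames reduce to \<open>shuffle_sign\<close>.\<close>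
lemma frame_sign_append:
  assumes "frame (vs @ ws)"
  shows "frame_sign (vs @ ws) =
    shuffle_sign (fst ` set vs) (fst ` set ws) * frame_sign vs * frame_sign ws"
  using assms
proof (induction vs)
  case Nil
  then show ?case by (simp add: shuffle_sign_def inversions_def)
next
  case (Cons v vs)
  have new: "fst v \<notin> fst ` set vs" and fr: "frame (vs @ ws)" and dw: "distinct (map fst ws)"
    using Cons.prems by (auto simp: frame_def)
  let ?less = "\<lambda>w :: sdir. dir_rank (fst w) < dir_rank (fst v)"
  have "inversions {fst v} (fst ` set ws) = Pair (fst v) ` set (map fst (filter ?less ws))"
    by (auto simp: inversions_def)
  then have "card (inversions {fst v} (fst ` set ws)) = card (set (map fst (filter ?less ws)))"
    by (simp add: card_image inj_on_def)
  also have "\<dots> = length (filter ?less ws)"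
    using dw by (metis distinct_card distinct_map_filter length_map)
  finally have "shuffle_sign {fst v} (fst ` set ws) = (-1) ^ length (filter ?less ws)"
    by (simp add: shuffle_sign_def)
  moreover have "shuffle_sign (fst ` set (v # vs)) (fst ` set ws) =
      shuffle_sign {fst v} (fst ` set ws) * shuffle_sign (fst ` set vs) (fst ` set ws)"
    using new shuffle_sign_Un_left[of "{fst v}" "fst ` set vs"] by simp
  ultimately show ?case
    using Cons.IH[OF fr] by (simp add: power_add)
qed

lemma frame_sign_pos_frames:
  assumes "D \<inter> E = {}"
  shows "frame_sign (pos_frame D @ pos_frame E) = shuffle_sign D E"
proof -
  have "frame (pos_frame D @ pos_frame E)"
    using assms pos_frame_simps(2,3)[of D] pos_frame_simps(2,3)[of E]
    by (auto simp: frame_def)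
  then show ?thesis by (simp add: frame_sign_append pos_frame_simps)
qed

lemma frame_sign_Cons_pos_frame:
  assumes "d \<notin> E" "s \<in> {1, -1}"
  shows "frame_sign ((d, s) # pos_frame E) = of_int s * shuffle_sign {d} E"
proof -
  have "frame ([(d, s)] @ pos_frame E)"
    using assms pos_frame_simps(2,3)[of E] by (auto simp: frame_def)
  from frame_sign_append[OF this] show ?thesis by (simp add: pos_frame_simps)
qed

section \<open>Boundary, coboundary and duality in coordinates\<close>

text \<open>The two ends of the cell of side length \<open>2h\<close> centered at \<open>q\<close> are the neighbours of \<open>q\<close> in the
  directions \<open>d\<close> and \<open>- d\<close>, so that these differences express incidence.\<close>
definition central_diff ::
  "dir \<Rightarrow> (('a::finite, 'b::finite, 'c::finite) site \<Rightarrow> real) \<Rightarrow> ('a, 'b, 'c) site \<Rightarrow> real" where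
  "central_diff d f q = f (shift q (d, 1)) - f (shift q (d, -1))"

lemma shift_commute: "shift (shift q (d, s)) (e, t) = shift (shift q (e, t)) (d, s)"
  by (cases q; cases d; cases e) (simp_all add: algebra_simps)

lemma shift_eq_iff: "shift p (d, s) = q \<longleftrightarrow> p = shift q (d, - s)"
  by (cases p; cases q; cases d) (auto simp: algebra_simps)

lemma central_diff_commute:
  "central_diff d (central_diff e f) = central_diff e (central_diff d f)"
  by (rule ext) (simp add: central_diff_def shift_commute[of _ d] algebra_simps)

lemma central_diff_sum:
  "central_diff d (\<lambda>p. \<Sum>i\<in>I. a i * f i p) q = (\<Sum>i\<in>I. a i * central_diff d (f i) q)"
  by (simp add: central_diff_def sum_subtractf right_diff_distrib)

lemma ocell_pos_frame_nth: "ocell p (pos_frame D) $ (q, E) = of_bool (p = q \<and> D = E)"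
  by (auto simp: ocell_def pos_frame_simps axis_def)

lemma chain_eqI:
  fixes a b :: "('a::finite, 'b::finite, 'c::finite) chain"
  assumes "\<And>q D. a $ (q, D) = b $ (q, D)"
  shows "a = b"
  unfolding vec_eq_iff using assms by (metis surj_pair)

lemma coboundary_adjoint: "x \<bullet> coboundary y = boundary x \<bullet> y"
  unfolding coboundary_def by (rule adjoint_works[OF linear_boundary])

lemma linear_coboundary: "linear coboundary"
  unfolding coboundary_def by (rule adjoint_linear[OF linear_boundary])

text \<open>Opposite outward normals induce opposite orientations, so that the facets of a cell come in
  pairs of opposite sign.\<close>
lemma cell_boundary_alt:
  "cell_boundary (p, D) = (\<Sum>d\<in>D. shuffle_sign {d} (D - {d}) *\<^sub>R
     (axis (shift p (d, 1), D - {d}) 1 - axis (shift p (d, -1), D - {d}) 1))"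
  unfolding cell_boundary_def
  by (intro sum.cong)
     (simp_all add: frame_sign_Cons_pos_frame scaleR_diff_right del: frame_sign.simps
       flip: axis_eq_ocell)

text \<open>A coordinate is the inner product with a cell, and by adjunction this is the inner product of
  \<open>c\<close> with the boundary of that cell.\<close>
lemma coboundary_nth:
  "coboundary c $ (q, D) =
     (\<Sum>d\<in>D. shuffle_sign {d} (D - {d}) * central_diff d (\<lambda>p. c $ (p, D - {d})) q)"
proof -
  have "coboundary c $ (q, D) = axis (q, D) 1 \<bullet> coboundary c"
    by (simp add: inner_axis')
  also have "\<dots> = cell_boundary (q, D) \<bullet> c"
    by (simp add: coboundary_adjoint boundary_axis)
  also have "\<dots> = (\<Sum>d\<in>D. shuffle_sign {d} (D - {d}) * central_diff d (\<lambda>p. c $ (p, D - {d})) q)"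
    by (simp add: cell_boundary_alt inner_sum_left inner_diff_left inner_axis' central_diff_def)
  finally show ?thesis .
qed

text \<open>The cell \<open>(q, E)\<close> is a facet of the cells \<open>(p, insert d E)\<close> with \<open>p\<close> one step away from \<open>q\<close>
  along \<open>d\<close>: the positive end of the one centered at \<open>shift q (d, -1)\<close> and the negative end of the
  one centered at \<open>shift q (d, 1)\<close>.  Hence the central difference appears with a minus sign.\<close>
lemma boundary_nth:
  fixes c :: "('a::finite, 'b::finite, 'c::finite) chain"
  shows "boundary c $ (q, E) =
    (\<Sum>d\<in>- E. - shuffle_sign {d} E * central_diff d (\<lambda>p. c $ (p, insert d E)) q)"
proof -
  \<comment> \<open>The contribution of the pair of facets of \<open>(p, D)\<close> across \<open>d\<close>, assuming \<open>D - {d} = E\<close>.\<close>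
  define g where "g d D p = c $ (p, D) * (shuffle_sign {d} (D - {d}) *
      (of_bool (shift p (d, 1) = q) - of_bool (shift p (d, -1) = q)))"
    for d D and p :: "('a, 'b, 'c) site"
  have ax: "axis (p, D) 1 $ (q, E) = of_bool (D = E) * (of_bool (p = q) :: real)" for p D
    by (auto simp: axis_def)
  have g: "(\<Sum>p\<in>UNIV. g d (insert d E) p) =
      - shuffle_sign {d} E * central_diff d (\<lambda>p. c $ (p, insert d E)) q" if "d \<notin> E" for d
  proof -
    let ?F = "\<lambda>p. shuffle_sign {d} E * c $ (p, insert d E)"
    have e: "shift p (d, 1) = q \<longleftrightarrow> p = shift q (d, -1)" "shift p (d, -1) = q \<longleftrightarrow> p = shift q (d, 1)"
      for p :: "('a, 'b, 'c) site"
      by (simp_all add: shift_eq_iff)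
    have "g d (insert d E) p =
        ?F p * of_bool (p = shift q (d, -1)) - ?F p * of_bool (p = shift q (d, 1))" for p
      using that unfolding g_def e by (simp add: right_diff_distrib mult_ac)
    then show ?thesis
      by (simp add: sum_subtractf central_diff_def right_diff_distrib)
  qed
  have "boundary c $ (q, E) = (\<Sum>(p, D)\<in>UNIV. \<Sum>d\<in>D. of_bool (D - {d} = E) * g d D p)"
    unfolding boundary_def sum_component
  proof (intro sum.cong refl, clarify)
    fix p :: "('a, 'b, 'c) site" and D
    show "((c $ (p, D)) *\<^sub>R cell_boundary (p, D)) $ (q, E) =
        (\<Sum>d\<in>D. of_bool (D - {d} = E) * g d D p)"
      unfolding cell_boundary_alt vector_scaleR_component sum_component real_scaleR_def
        vector_minus_component ax sum_distrib_left
      by (intro sum.cong refl) (simp add: g_def algebra_simps)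
  qed
  also have "\<dots> = (\<Sum>p\<in>UNIV. \<Sum>D\<in>UNIV. \<Sum>d\<in>UNIV. of_bool (d \<in> D \<and> D - {d} = E) * g d D p)"
    unfolding UNIV_Times_UNIV[symmetric] sum.cartesian_product[symmetric]
    by (intro sum.cong refl sum.mono_neutral_cong_left) auto
  also have "\<dots> = (\<Sum>d\<in>UNIV. \<Sum>p\<in>UNIV. \<Sum>D\<in>UNIV. of_bool (d \<in> D \<and> D - {d} = E) * g d D p)"
    by (subst (3) sum.swap, intro sum.cong refl, rule sum.swap)
  also have "\<dots> = (\<Sum>d\<in>UNIV. \<Sum>p\<in>UNIV. of_bool (d \<notin> E) * g d (insert d E) p)"
  proof (intro sum.cong refl)
    fix d p
    have "(d \<in> D \<and> D - {d} = E) \<longleftrightarrow> (D = insert d E \<and> d \<notin> E)" for D by auto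
    then have "(\<Sum>D\<in>UNIV. of_bool (d \<in> D \<and> D - {d} = E) * g d D p) =
        (\<Sum>D\<in>UNIV. if D = insert d E then of_bool (d \<notin> E) * g d D p else 0)"
      by (intro sum.cong) auto
    then show "(\<Sum>D\<in>UNIV. of_bool (d \<in> D \<and> D - {d} = E) * g d D p) =
        of_bool (d \<notin> E) * g d (insert d E) p" by simp
  qed
  also have "\<dots> = (\<Sum>d\<in>- E. \<Sum>p\<in>UNIV. g d (insert d E) p)"
    by (rule sum.mono_neutral_cong_right) auto
  also have "\<dots> = (\<Sum>d\<in>- E. - shuffle_sign {d} E * central_diff d (\<lambda>p. c $ (p, insert d E)) q)"
    by (intro sum.cong) (simp_all add: g)
  finally show ?thesis .
qed

text \<open>The coefficient of the cell \<open>(q, - D)\<close> in the dual of the cell \<open>(q, D)\<close>.\<close>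
definition star_sign :: "dir set \<Rightarrow> real" where
  "star_sign D = dual_sign (card D) * shuffle_sign D (- D)"

lemma star_nth: "star c $ (q, D) = star_sign (- D) * c $ (q, - D)"
proof -
  have "star c $ (q, D) = (\<Sum>\<sigma>\<in>UNIV. if \<sigma> = (q, - D) then star_sign (- D) * c $ (q, - D) else 0)"
    unfolding star_def sum_component
    by (intro sum.cong) (auto simp: frame_sign_pos_frames star_sign_def ocell_pos_frame_nth)
  then show ?thesis by simp
qed

lemma linear_star: "linear star"
  by (rule linearI) (simp_all add: vec_eq_iff star_nth algebra_simps)

lemma card_dir: "card (UNIV :: dir set) = 3"
  by (simp add: UNIV_dir)

lemma card_Compl_dir: "card (- D) = 3 - card D" "card D \<le> 3" for D :: "dir set"
  using card_Diff_subset[of D UNIV] card_mono[of UNIV D]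
  by (simp_all add: card_dir Compl_eq_Diff_UNIV)

text \<open>Exchanging complementary frames costs \<open>(-1) ^ (k * (3 - k))\<close>, which is 1 for every \<open>k \<le> 3\<close>;
  this is where the odd dimension of space enters.  The degree dependent signs are symmetric under
  \<open>k \<mapsto> 3 - k\<close>.\<close>
lemma star_sign_Compl: "star_sign D * star_sign (- D) = 1"
proof -
  let ?k = "card D"
  have "star_sign D * star_sign (- D) =
      dual_sign ?k * dual_sign (3 - ?k) * (shuffle_sign D (- D) * shuffle_sign (- D) D)"
    by (simp add: star_sign_def card_Compl_dir)
  also have "\<dots> = dual_sign ?k * dual_sign (3 - ?k) * (-1) ^ (?k * (3 - ?k))"
    by (simp add: shuffle_sign_swap card_Compl_dir)
  also have "\<dots> = 1"
  proof -
    have "?k = 0 \<or> ?k = 1 \<or> ?k = 2 \<or> ?k = 3" using card_Compl_dir(2)[of D] by linarith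
    then show ?thesis by (elim disjE) (simp_all only: dual_sign_def, simp_all)
  qed
  finally show ?thesis .
qed

lemma star_star: "star (star c) = c"
proof (rule chain_eqI)
  show "star (star c) $ (q, D) = c $ (q, D)" for q D
    using star_sign_Compl[of D] by (simp add: star_nth mult.commute flip: mult.assoc)
qed

text \<open>By \<open>frame_sign_append\<close>, replacing the standard frames of the two cells by \<open>vs\<close> and \<open>ws\<close>
  changes both sides by the signs of these frames.\<close>
lemma star_ocell:
  assumes "frame (vs @ ws)" "length (vs @ ws) = 3"
  shows "star (ocell q vs) = (dual_sign (length vs) * frame_sign (vs @ ws)) *\<^sub>R ocell q ws"
proof -
  let ?D = "fst ` set vs" and ?E = "fst ` set ws"
  have dv: "distinct (map fst vs)" and dj: "?D \<inter> ?E = {}" and fw: "frame ws"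
    using assms(1) by (auto simp: frame_def)
  have card: "card ?D = length vs"
    using distinct_card[OF dv] by simp
  have "card (?D \<union> ?E) = 3"
    using assms distinct_card[of "map fst (vs @ ws)"] by (simp add: frame_def image_Un)
  then have "?D \<union> ?E = UNIV"
    using card_subset_eq[of UNIV "?D \<union> ?E"] card_dir by simp
  with dj have E: "?E = - ?D" by blast
  have "frame_sign (vs @ ws) * frame_sign ws = shuffle_sign ?D (- ?D) * frame_sign vs"
    using frame_sign_square[OF fw] by (simp add: frame_sign_append[OF assms(1)] E mult.assoc)
  then have sgn: "dual_sign (length vs) * frame_sign (vs @ ws) * frame_sign ws =
      star_sign ?D * frame_sign vs"
    by (simp add: star_sign_def card mult.assoc)
  have "star (ocell q vs) = (star_sign ?D * frame_sign vs) *\<^sub>R axis (q, - ?D) 1"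
    by (auto simp: vec_eq_iff star_nth ocell_def axis_def)
  then show ?thesis
    unfolding sgn[symmetric] by (simp add: ocell_def E)
qed

section \<open>Chains of fixed degree\<close>

text \<open>In this form the degree of a chain can be read off its coordinates, which makes the behaviour of
  all operators with respect to the grading a matter of counting directions.  It covers the
  integers outside \<open>{0..3}\<close> as well.\<close>
lemma chain_space_iff: "c \<in> chain_space i \<longleftrightarrow> (\<forall>q D. int (card D) \<noteq> i \<longrightarrow> c $ (q, D) = 0)"
  (is "_ \<longleftrightarrow> ?supp c")
proof
  have sub: "subspace {c. ?supp c}"
    by (auto simp: subspace_def)
  assume "c \<in> chain_space i"
  moreover have "chain_space i \<subseteq> {c. ?supp c}"
    unfolding chain_space_def
  proof (rule span_minimal[OF _ sub], safe)
    fix q p :: "('a, 'b, 'c) site" and vs and D :: "dir set"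
    assume fr: "frame vs" and D: "int (card D) \<noteq> int (length vs)"
    have "card (fst ` set vs) = length vs"
      using fr distinct_card[of "map fst vs"] by (simp add: frame_def)
    then show "ocell q vs $ (p, D) = 0"
      using D by (auto simp: ocell_def axis_def)
  qed
  ultimately show "?supp c" by blast
next
  assume s: "?supp c"
  have "(\<Sum>(q, D)\<in>UNIV. (c $ (q, D)) *\<^sub>R ocell q (pos_frame D)) \<in> chain_space i"
    unfolding chain_space_def case_prod_beta
  proof (rule span_sum)
    fix x :: "('a, 'b, 'c) cell"
    show "(c $ (fst x, snd x)) *\<^sub>R ocell (fst x) (pos_frame (snd x))
      \<in> span {ocell q vs |q vs. frame vs \<and> int (length vs) = i}"
    proof (cases "int (card (snd x)) = i")
      case True
      then show ?thesis
        using pos_frame_simps(2,4)[of "snd x"]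
        by (intro span_scale span_base CollectI exI[of _ "fst x"] exI[of _ "pos_frame (snd x)"]) simp
    next
      case False
      then have "c $ (fst x, snd x) = 0" using s by blast
      then show ?thesis by (simp add: span_zero)
    qed
  qed
  then show "c \<in> chain_space i" by (simp flip: chain_expansion)
qed

lemma chain_spaceD: "c \<in> chain_space i \<Longrightarrow> int (card D) \<noteq> i \<Longrightarrow> c $ (q, D) = 0"
  unfolding chain_space_iff by blast

lemma subspace_chain_space: "subspace (chain_space i)"
  unfolding chain_space_def by (rule subspace_span)

lemma boundary_chain_space: "boundary ` chain_space i \<subseteq> chain_space (i - 1)"
proof safe
  fix c :: "('a, 'b, 'c) chain" assume c: "c \<in> chain_space i"
  have "c $ (p, insert d D) = 0" if "int (card D) \<noteq> i - 1" "d \<notin> D" for p and D :: "dir set" and d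
    by (rule chain_spaceD[OF c]) (use that in simp)
  then show "boundary c \<in> chain_space (i - 1)"
    unfolding chain_space_iff boundary_nth central_diff_def by (auto intro!: sum.neutral)
qed

lemma coboundary_chain_space: "coboundary ` chain_space i \<subseteq> chain_space (i + 1)"
proof safe
  fix c :: "('a, 'b, 'c) chain" assume c: "c \<in> chain_space i"
  have "c $ (p, D - {d}) = 0" if "int (card D) \<noteq> i + 1" "d \<in> D" for p and D :: "dir set" and d
  proof -
    have "card D = Suc (card (D - {d}))" using that by (intro card.remove) auto
    then have "int (card (D - {d})) \<noteq> i" using that by simp
    then show ?thesis by (rule chain_spaceD[OF c])
  qed
  then show "coboundary c \<in> chain_space (i + 1)"
    unfolding chain_space_iff coboundary_nth central_diff_def by (auto intro!: sum.neutral)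
qed

lemma star_chain_space: "star ` chain_space i \<subseteq> chain_space (3 - i)"
proof safe
  fix c :: "('a, 'b, 'c) chain" assume c: "c \<in> chain_space i"
  have "int (card (- D)) \<noteq> i" if "int (card D) \<noteq> 3 - i" for D :: "dir set"
    using that card_Compl_dir[of D] by auto
  then show "star c \<in> chain_space (3 - i)"
    using c by (auto simp: chain_space_iff star_nth)
qed

lemma bij_betw_star: "bij_betw star (chain_space i) (chain_space (3 - i))"
  by (rule bij_betw_byWitness[where f' = star])
     (use star_chain_space[of i] star_chain_space[of "3 - i"] in \<open>auto simp: star_star\<close>)

section \<open>The relations between boundary, coboundary and duality\<close>

text \<open>The coefficient at \<open>(q, E)\<close> is a sum over ordered pairs of distinct directions \<open>d\<close>, \<open>e\<close> outside \<open>E\<close>.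
  The differences along \<open>d\<close> and \<open>e\<close> commute, and of the three signs involved only
  \<open>shuffle_sign {e} {d}\<close> changes when \<open>d\<close> and \<open>e\<close> are exchanged, so the terms cancel in pairs.\<close>
lemma boundary_boundary: "boundary (boundary c) = 0"
proof -
  have "boundary (boundary c) $ (q, E) = 0" for q E
  proof -
    \<comment> \<open>Extended by 0 to the diagonal, so that both sums run over \<open>- E\<close> and can be exchanged.\<close>
    define g where "g d e = of_bool (d \<noteq> e) *
        (shuffle_sign {d} E * shuffle_sign {e} E * shuffle_sign {e} {d} *
        central_diff d (central_diff e (\<lambda>p. c $ (p, insert d (insert e E)))) q)" for d e
    have anti: "g d e = - g e d" for d e
    proof (cases "d = e")
      case False
      then have "shuffle_sign {d} {e} * shuffle_sign {e} {d} = -1"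
        by (simp add: shuffle_sign_swap)
      then have "shuffle_sign {d} {e} * (shuffle_sign {d} {e} * shuffle_sign {e} {d}) =
          - shuffle_sign {d} {e}" by simp
      then have "shuffle_sign {e} {d} = - shuffle_sign {d} {e}"
        by (simp add: shuffle_sign_square flip: mult.assoc)
      then show ?thesis
        unfolding g_def insert_commute[of d e] central_diff_commute[of d e] by simp
    qed (simp add: g_def)
    have "boundary (boundary c) $ (q, E) = (\<Sum>d\<in>- E. \<Sum>e\<in>- E. g d e)"
      unfolding boundary_nth central_diff_sum
    proof (intro sum.cong refl, unfold sum_distrib_left, rule sum.mono_neutral_cong_left, goal_cases)
      case (4 d e)
      then have "shuffle_sign {e} (insert d E) = shuffle_sign {e} {d} * shuffle_sign {e} E"
        using shuffle_sign_Un_right[of "{d}" E "{e}"] by simp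
      then show ?case using 4 by (auto simp: g_def insert_commute)
    qed (auto simp: g_def)
    moreover have "(\<Sum>d\<in>- E. \<Sum>e\<in>- E. g d e) = - (\<Sum>d\<in>- E. \<Sum>e\<in>- E. g d e)"
      by (subst sum.swap, subst anti) (simp add: sum_negf)
    ultimately show ?thesis by simp
  qed
  then show ?thesis by (intro chain_eqI) simp
qed

lemma coboundary_coboundary: "coboundary (coboundary c) = 0"
proof -
  have "x \<bullet> coboundary (coboundary c) = 0" for x
    by (simp add: coboundary_adjoint boundary_boundary)
  then show ?thesis by (metis inner_eq_zero_iff)
qed

lemma dual_sign_Suc: "dual_sign (Suc k) = (-1) ^ Suc k * dual_sign k"
proof -
  have "Suc k * (Suc k + 1) div 2 = Suc k + k * (k + 1) div 2"
    by (simp add: algebra_simps)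
  then show ?thesis by (simp add: dual_sign_def power_add)
qed

text \<open>The comparison of signs behind \<open>\<star> \<circ> \<delta> = \<partial> \<circ> \<star>\<close>.  Here \<open>F\<close>, \<open>{d}\<close> and \<open>E\<close> partition the directions.
  Up to the common factor \<open>shuffle_sign F E * shuffle_sign {d} E\<close>, the two sides differ by moving \<open>d\<close> past \<open>F\<close>, which costs
  \<open>(-1) ^ card F\<close>, and by \<open>dual_sign (card F + 1) / dual_sign (card F) = (-1) ^ (card F + 1)\<close>.  The
  remaining minus sign is the one by which \<open>boundary_nth\<close> and \<open>coboundary_nth\<close> differ.\<close>
lemma star_sign_insert:
  assumes "d \<notin> F"
  defines "E \<equiv> - insert d F"
  shows "shuffle_sign {d} E * star_sign F = - star_sign (insert d F) * shuffle_sign {d} F"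
proof -
  have cF: "- F = {d} \<union> E" and cdF: "- insert d F = E"
    using assms by auto
  have F: "star_sign F = dual_sign (card F) * (shuffle_sign F {d} * shuffle_sign F E)"
    unfolding star_sign_def cF by (subst shuffle_sign_Un_right) (auto simp: E_def)
  have "star_sign (insert d F) =
      dual_sign (Suc (card F)) * (shuffle_sign {d} E * shuffle_sign F E)"
    using assms(1) shuffle_sign_Un_left[of "{d}" F E] by (simp add: star_sign_def flip: cdF)
  then have dF: "star_sign (insert d F) =
      - ((-1) ^ card F) * dual_sign (card F) * (shuffle_sign {d} E * shuffle_sign F E)"
    by (simp add: dual_sign_Suc)
  have "shuffle_sign F {d} * shuffle_sign {d} F = (-1) ^ card F"
    using assms(1) by (simp add: shuffle_sign_swap)
  then have "shuffle_sign F {d} = (-1) ^ card F * shuffle_sign {d} F"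
    using shuffle_sign_square[of "{d}" F] by (metis mult.assoc mult.right_neutral)
  then show ?thesis unfolding F dF by (simp add: algebra_simps)
qed

text \<open>Both sides are sums over \<open>d \<in> - E\<close> of the same central difference of \<open>c\<close> on the cells of type
  \<open>- E - {d}\<close>, since complementation exchanges removing and inserting a direction.\<close>
lemma star_coboundary: "star (coboundary c) = boundary (star c)"
proof -
  have "star (coboundary c) $ (q, E) = boundary (star c) $ (q, E)" for q E
  proof -
    have "star (coboundary c) $ (q, E) = (\<Sum>d\<in>- E. star_sign (- E) *
        (shuffle_sign {d} (- E - {d}) * central_diff d (\<lambda>p. c $ (p, - E - {d})) q))"
      by (simp add: star_nth coboundary_nth sum_distrib_left)
    also have "\<dots> = boundary (star c) $ (q, E)"
      unfolding boundary_nth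
    proof (intro sum.cong refl)
      fix d assume d: "d \<in> - E"
      let ?F = "- E - {d}"
      have F: "insert d ?F = - E" "- insert d ?F = E" "- insert d E = ?F" using d by auto
      have "shuffle_sign {d} E * star_sign ?F = - star_sign (- E) * shuffle_sign {d} ?F"
        using star_sign_insert[of d ?F] by (simp only: F) simp
      moreover have "central_diff d (\<lambda>p. star c $ (p, insert d E)) q =
          star_sign ?F * central_diff d (\<lambda>p. c $ (p, ?F)) q"
        by (simp add: star_nth F central_diff_def right_diff_distrib)
      ultimately show "star_sign (- E) * (shuffle_sign {d} ?F * central_diff d (\<lambda>p. c $ (p, ?F)) q) =
          - shuffle_sign {d} E * central_diff d (\<lambda>p. star c $ (p, insert d E)) q"
        by (metis (no_types, lifting) minus_mult_left minus_minus mult.assoc)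
    qed
    finally show ?thesis .
  qed
  then show ?thesis by (rule chain_eqI)
qed

lemma star_boundary: "star (boundary c) = coboundary (star c)"
  by (metis star_coboundary star_star)

section \<open>Transversality of dual cells, and lattice vector fields\<close>

text \<open>A point of both cells agrees with a lift of \<open>q\<close> in each coordinate: in the directions of \<open>D\<close>
  because of the cell \<open>(q, - D)\<close>, in the others because of \<open>(q, D)\<close>.  The lifts used by the
  two cells may be different, and are combined coordinate by coordinate.\<close>
lemma cell_points_dual:
  assumes "h > 0"
  shows "cell_points h (q, D) \<inter> cell_points h (q, - D) = cell_points h (q, {})"
proof (intro equalityI subsetI)
  fix p assume "p \<in> cell_points h (q, D) \<inter> cell_points h (q, - D)"
  then obtain m n :: "dir \<Rightarrow> int" where
    m: "\<And>d. \<bar>p $ d - h * real_of_int (coord q d + m d * period q d)\<bar> \<le> (if d \<in> D then h else 0)" and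
    n: "\<And>d. \<bar>p $ d - h * real_of_int (coord q d + n d * period q d)\<bar> \<le> (if d \<in> - D then h else 0)"
    by (auto simp: cell_points_def)
  have "\<bar>p $ d - h * real_of_int (coord q d + (if d \<in> D then n d else m d) * period q d)\<bar> \<le> 0" for d
    using m[of d] n[of d] by (cases "d \<in> D") simp_all
  then show "p \<in> cell_points h (q, {})"
    by (auto simp: cell_points_def intro!: exI[of _ "\<lambda>d. if d \<in> D then n d else m d"])
next
  fix p assume "p \<in> cell_points h (q, {})"
  then obtain m :: "dir \<Rightarrow> int" where
    m: "\<And>d. \<bar>p $ d - h * real_of_int (coord q d + m d * period q d)\<bar> \<le> 0"
    by (auto simp: cell_points_def)
  have "\<bar>p $ d - h * real_of_int (coord q d + m d * period q d)\<bar> \<le> (if d \<in> E then h else 0)" for d E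
    using m[of d] assms by simp
  then show "p \<in> cell_points h (q, D) \<inter> cell_points h (q, - D)"
    unfolding cell_points_def by (simp only: fst_conv snd_conv Int_iff mem_Collect_eq) blast
qed

lemma braces_nth: "braces V $ (q, D) = (\<Sum>d\<in>UNIV. if D = {d} then V $ q $ d else 0)"
proof -
  have "ocell p [(d, 1)] $ (q, D) = of_bool (p = q \<and> D = {d})" for p d
    by (auto simp: ocell_def axis_def)
  then have "braces V $ (q, D) =
      (\<Sum>p\<in>UNIV. if p = q then (\<Sum>d\<in>UNIV. if D = {d} then V $ q $ d else 0) else 0)"
    unfolding braces_def sum_component
    by (intro sum.cong refl) (auto simp del: sum_mult_of_bool_eq intro!: sum.cong)
  then show ?thesis by simp
qed

lemma linear_braces: "linear (braces :: ('a::finite, 'b::finite, 'c::finite) field \<Rightarrow> _)"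
proof (rule linearI; rule chain_eqI)
  fix V W :: "('a, 'b, 'c) field" and r q D
  show "braces (V + W) $ (q, D) = (braces V + braces W) $ (q, D)"
    by (simp add: braces_nth flip: sum.distrib) (intro sum.cong; simp)
  show "braces (r *\<^sub>R V) $ (q, D) = (r *\<^sub>R braces V) $ (q, D)"
    by (simp add: braces_nth sum_distrib_left) (intro sum.cong; simp)
qed

lemma braces_edge: "braces V $ (q, {d}) = V $ q $ d"
  by (simp add: braces_nth)

lemma bij_betw_braces:
  "bij_betw (braces :: ('a::finite, 'b::finite, 'c::finite) field \<Rightarrow> _) UNIV (chain_space 1)"
proof -
  define f :: "('a, 'b, 'c) chain \<Rightarrow> ('a, 'b, 'c) field" where "f c = (\<chi> q d. c $ (q, {d}))" for c
  have supp: "braces V $ (q, D) = 0" if "card D \<noteq> 1"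
    for V :: "('a, 'b, 'c) field" and q D
    using that by (auto simp: braces_nth intro!: sum.neutral)
  have range: "range (braces :: ('a, 'b, 'c) field \<Rightarrow> _) \<subseteq> chain_space 1"
    unfolding chain_space_iff image_subset_iff by (intro ballI allI impI supp) simp
  have left: "f (braces V) = V" for V
    by (simp add: f_def vec_eq_iff braces_edge)
  have right: "braces (f c) = c" if c: "c \<in> chain_space 1" for c
  proof (rule chain_eqI)
    fix q D
    show "braces (f c) $ (q, D) = c $ (q, D)"
    proof (cases "card D = 1")
      case True
      then obtain d where "D = {d}" by (auto simp: card_1_singleton_iff)
      then show ?thesis by (simp add: f_def braces_edge)
    next
      case False
      then show ?thesis using chain_spaceD[OF c] supp by simp
    qed
  qed
  show ?thesis
    by (rule bij_betw_byWitness[where f' = f]) (use left right range in auto)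
qed

section \<open>The Hodge decomposition\<close>

text \<open>Uniqueness of the components is automatic: pairwise orthogonal vectors with sum 0 vanish, as one
  sees by taking the inner product of the sum with each of them.\<close>
lemma orthogonal_direct_sum3I:
  fixes A B C V :: "'v::real_inner set"
  assumes sub: "subspace A" "subspace B" "subspace C"
    and AB: "\<And>a b. a \<in> A \<Longrightarrow> b \<in> B \<Longrightarrow> orthogonal a b"
    and AC: "\<And>a c. a \<in> A \<Longrightarrow> c \<in> C \<Longrightarrow> orthogonal a c"
    and BC: "\<And>b c. b \<in> B \<Longrightarrow> c \<in> C \<Longrightarrow> orthogonal b c"
    and V: "V = {a + b + c | a b c. a \<in> A \<and> b \<in> B \<and> c \<in> C}"
  shows "orthogonal_direct_sum3 V A B C"
proof -
  have zero: "a = 0 \<and> b = 0 \<and> c = 0"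
    if "a \<in> A" "b \<in> B" "c \<in> C" and s: "a + b + c = 0" for a b c
  proof -
    have o: "a \<bullet> b = 0" "a \<bullet> c = 0" "b \<bullet> c = 0"
      using AB AC BC that by (auto simp: orthogonal_def)
    have "a \<bullet> (a + b + c) = 0" "b \<bullet> (a + b + c) = 0" "c \<bullet> (a + b + c) = 0"
      by (simp_all add: s)
    then show ?thesis using o by (simp add: inner_add_right inner_commute)
  qed
  have "\<exists>!t. t \<in> A \<times> B \<times> C \<and> v = fst t + fst (snd t) + snd (snd t)" if "v \<in> V" for v
  proof -
    from that V obtain a b c where abc: "a \<in> A" "b \<in> B" "c \<in> C" "v = a + b + c" by blast
    show ?thesis
    proof (rule ex1I[of _ "(a, b, c)"])
      show "(a, b, c) \<in> A \<times> B \<times> C \<and> v = fst (a, b, c) + fst (snd (a, b, c)) + snd (snd (a, b, c))"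
        using abc by simp
      fix t assume t: "t \<in> A \<times> B \<times> C \<and> v = fst t + fst (snd t) + snd (snd t)"
      obtain a' b' c' where t': "t = (a', b', c')" by (cases t)
      have "a' - a = 0 \<and> b' - b = 0 \<and> c' - c = 0"
      proof (rule zero)
        show "a' - a \<in> A" "b' - b \<in> B" "c' - c \<in> C"
          using t t' abc sub by (auto intro: subspace_diff)
        show "(a' - a) + (b' - b) + (c' - c) = 0"
          using t t' abc by (simp add: algebra_simps)
      qed
      then show "t = (a, b, c)" by (simp add: t')
    qed
  qed
  then show ?thesis
    unfolding orthogonal_direct_sum3_def using sub AB AC BC by (intro conjI V) simp_all
qed

text \<open>\<open>U\<close>, \<open>V\<close> and \<open>W\<close> are the parts of degree \<open>i + 1\<close>, \<open>i\<close> and \<open>i - 1\<close> of a complex, all inside one space.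
  The images are orthogonal since \<open>d x \<bullet> \<delta> y = d (d x) \<bullet> y = 0\<close>.  The component \<open>t\<close> of a vector
  orthogonal to both images satisfies \<open>\<delta> t \<bullet> \<delta> t = t \<bullet> d (\<delta> t) = 0\<close> and
  \<open>d t \<bullet> d t = t \<bullet> \<delta> (d t) = 0\<close>, hence lies in the kernel of the Laplacian.\<close>
lemma hodge_decomposition:
  fixes d \<delta> :: "'v::euclidean_space \<Rightarrow> 'v"
  assumes lin: "linear d" "linear \<delta>"
    and adj: "\<And>x y. x \<bullet> \<delta> y = d x \<bullet> y"
    and dd: "\<And>x. d (d x) = 0"
    and sub: "subspace U" "subspace V" "subspace W"
    and dU: "d ` U \<subseteq> V" and dV: "d ` V \<subseteq> W"
    and \<delta>W: "\<delta> ` W \<subseteq> V" and \<delta>V: "\<delta> ` V \<subseteq> U"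
  shows "orthogonal_direct_sum3 V (d ` U) (\<delta> ` W) {c \<in> V. d (\<delta> c) + \<delta> (d c) = 0}"
proof -
  let ?K = "{c \<in> V. d (\<delta> c) + \<delta> (d c) = 0}"
  have adj': "\<delta> y \<bullet> x = y \<bullet> d x" for x y
    using adj[of x y] by (simp add: inner_commute)
  have harmonic: "d c = 0 \<and> \<delta> c = 0" if "c \<in> ?K" for c
  proof -
    have "d (\<delta> c) \<bullet> c + \<delta> (d c) \<bullet> c = 0"
      using that by (simp flip: inner_add_left)
    then have "\<delta> c \<bullet> \<delta> c + d c \<bullet> d c = 0"
      using adj[of "\<delta> c" c] adj'[of "d c" c] by simp
    then show ?thesis
      by (metis add_nonneg_eq_0_iff inner_ge_zero inner_eq_zero_iff)
  qed
  have AB: "orthogonal a b" if "a \<in> d ` U" "b \<in> \<delta> ` W" for a b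
    using that by (auto simp: orthogonal_def adj dd)
  have AC: "orthogonal a c" if "a \<in> d ` U" "c \<in> ?K" for a c
  proof -
    from that obtain x where "a = d x" by blast
    then show ?thesis using adj[of x c] harmonic[OF that(2)] by (simp add: orthogonal_def)
  qed
  have BC: "orthogonal b c" if "b \<in> \<delta> ` W" "c \<in> ?K" for b c
  proof -
    from that obtain x where "b = \<delta> x" by blast
    then show ?thesis using adj'[of x c] harmonic[OF that(2)] by (simp add: orthogonal_def)
  qed
  have sA: "subspace (d ` U)" and sB: "subspace (\<delta> ` W)"
    using lin sub by (auto intro: linear_subspace_image)
  have "linear (\<lambda>c. d (\<delta> c) + \<delta> (d c))"
    using linear_compose_add[OF linear_compose[OF lin(2,1)] linear_compose[OF lin]]
    by (simp add: o_def)
  then have sK: "subspace ?K"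
    using subspace_inter[OF sub(2) linear_subspace_kernel] by (simp add: Int_def)
  have "V \<subseteq> {a + b + c | a b c. a \<in> d ` U \<and> b \<in> \<delta> ` W \<and> c \<in> ?K}"
  proof
    fix v assume v: "v \<in> V"
    let ?S = "{a + b | a b. a \<in> d ` U \<and> b \<in> \<delta> ` W}"
    have sS: "subspace ?S" by (rule subspace_sums[OF sA sB])
    have sp: "span ?S = ?S" using sS by (simp only: span_eq_iff)
    \<comment> \<open>Orthogonal projection to the sum of the two images.\<close>
    obtain s t where s: "s \<in> ?S" and t: "\<And>w. w \<in> ?S \<Longrightarrow> orthogonal t w" and st: "v = s + t"
      by (rule orthogonal_subspace_decomp_exists[of ?S v, unfolded sp]) blast
    from s have "s \<in> V" using dU \<delta>W by (blast intro: subspace_add[OF sub(2)])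
    then have tV: "t \<in> V" using subspace_diff[OF sub(2) v \<open>s \<in> V\<close>] st by simp
    have S: "a + b \<in> ?S" if "a \<in> d ` U" "b \<in> \<delta> ` W" for a b
      using that by blast
    have "d (\<delta> t) + 0 \<in> ?S"
      using tV \<delta>V by (intro S subspace_0[OF sB]) blast
    then have "t \<bullet> d (\<delta> t) = 0" using t by (fastforce simp: orthogonal_def)
    then have "\<delta> t = 0" using adj'[of t "\<delta> t"] by simp
    have "0 + \<delta> (d t) \<in> ?S"
      using tV dV by (intro S subspace_0[OF sA]) blast
    then have "t \<bullet> \<delta> (d t) = 0" using t by (fastforce simp: orthogonal_def)
    then have "d t = 0" using adj[of t "d t"] by simp
    with \<open>\<delta> t = 0\<close> tV have "t \<in> ?K" by (simp add: linear_0 lin)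
    then show "v \<in> {a + b + c | a b c. a \<in> d ` U \<and> b \<in> \<delta> ` W \<and> c \<in> ?K}"
      using s st by blast
  qed
  moreover have "{a + b + c | a b c. a \<in> d ` U \<and> b \<in> \<delta> ` W \<and> c \<in> ?K} \<subseteq> V"
    using dU \<delta>W by (blast intro: subspace_add[OF sub(2)])
  ultimately show ?thesis
    using sA sB sK AB AC BC by (intro orthogonal_direct_sum3I) auto
qed

lemma hodge_chain_space:
  "orthogonal_direct_sum3 (chain_space i) (boundary ` chain_space (i + 1))
     (coboundary ` chain_space (i - 1)) {c \<in> chain_space i. laplacian c = 0}"
  unfolding laplacian_def
  by (rule hodge_decomposition)
     (use boundary_chain_space[of "i + 1"] coboundary_chain_space[of "i - 1"] in
      \<open>simp_all add: linear_boundary linear_coboundary coboundary_adjoint boundary_boundary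
        subspace_chain_space boundary_chain_space coboundary_chain_space\<close>)

lemma laplacian_degree_0:
  assumes "c \<in> chain_space 0"
  shows "laplacian c = boundary (coboundary c)"
proof -
  have "boundary c = 0"
    using assms boundary_chain_space[of 0] chain_space_trivial(1) by auto
  then show ?thesis by (simp add: laplacian_def linear_0 linear_coboundary)
qed

theorem theorem4p1:
  fixes h :: real
  assumes "h > 0"
  shows
    "(linear (star :: ('a::finite, 'b::finite, 'c::finite) chain \<Rightarrow> ('a, 'b, 'c) chain) \<and>
      (\<forall>i\<in>{0..3}. bij_betw star (chain_space i :: ('a, 'b, 'c) chain set) (chain_space (3 - i))) \<and>
      (\<forall>c :: ('a, 'b, 'c) chain. star (star c) = c) \<and>
      (\<forall>(q :: ('a, 'b, 'c) site) vs ws. frame (vs @ ws) \<and> length (vs @ ws) = 3 \<longrightarrow>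
         star (ocell q vs) = (dual_sign (length vs) * frame_sign (vs @ ws)) *\<^sub>R ocell q ws) \<and>
      (\<forall>(q :: ('a, 'b, 'c) site) D.
         cell_points h (q, D) \<inter> cell_points h (q, - D) = cell_points h (q, {})))
     \<and>
     (linear (braces :: ('a, 'b, 'c) field \<Rightarrow> ('a, 'b, 'c) chain) \<and>
      bij_betw (braces :: ('a, 'b, 'c) field \<Rightarrow> ('a, 'b, 'c) chain) UNIV (chain_space 1))
     \<and>
     (linear (boundary :: ('a, 'b, 'c) chain \<Rightarrow> ('a, 'b, 'c) chain) \<and>
      linear (coboundary :: ('a, 'b, 'c) chain \<Rightarrow> ('a, 'b, 'c) chain) \<and>
      (\<forall>i\<in>{0..3}. boundary ` (chain_space i :: ('a, 'b, 'c) chain set) \<subseteq> chain_space (i - 1)) \<and>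
      (\<forall>i\<in>{0..3}. coboundary ` (chain_space i :: ('a, 'b, 'c) chain set) \<subseteq> chain_space (i + 1)) \<and>
      (\<forall>c :: ('a, 'b, 'c) chain.
         boundary (boundary c) = 0 \<and>
         coboundary (coboundary c) = 0 \<and>
         star (coboundary c) = boundary (star c) \<and>
         star (boundary c) = coboundary (star c)))
     \<and>
     ((\<forall>c \<in> (chain_space 0 :: ('a, 'b, 'c) chain set). laplacian c = boundary (coboundary c)) \<and>
      (\<forall>i\<in>{0..3}. orthogonal_direct_sum3 (chain_space i :: ('a, 'b, 'c) chain set)
         (boundary ` chain_space (i + 1))
         (coboundary ` chain_space (i - 1))
         {c \<in> chain_space i. laplacian c = 0}))"
  using assms
  by (intro conjI ballI allI impI)
     (simp_all only: linear_star bij_betw_star star_star star_ocell cell_points_dual linear_braces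
       bij_betw_braces linear_boundary linear_coboundary boundary_chain_space coboundary_chain_space
       boundary_boundary coboundary_coboundary star_coboundary star_boundary laplacian_degree_0
       hodge_chain_space)

end
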